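(* Let $(X,\mathcal{U})$ be a uniform space. If $f\colon(X,\mathcal{U})\to(X,\mathcal{U})$ is continuous, then $\widehat{f}\colon(\mathcal{F}(X),\mathcal{U}_\infty)\to(\mathcal{F}(X),\mathcal{U}_\infty)$ is continuous.
   Context: A uniform space $(X,\mathcal{U})$ is a non-empty set $X$ with a uniformity $\mathcal{U}$ given by entourages of the diagonal, assumed separated: $\bigcap_{U\in\mathcal{U}}U=\Delta_X$. For $U\in\mathcal{U}$, $x\in X$, $A\subseteq X$, put $U(x)=\{y\in X:(x,y)\in U\}$ and $U(A)=\bigcup_{x\in A}U(x)$. The induced topology is $\tau(\mathcal{U})=\{V\subseteq X: \text{for every }x\in V\text{ there is }U\in\mathcal{U}\text{ with }U(x)\subseteq V\}$. Continuity of maps between uniform spaces always means continuity with respect to the induced topologies (not uniform continuity). $\mathcal{K}(X)$ is the set of non-empty compact subsets of $(X,\tau(\mathcal{U}))$, and for $U\in\mathcal{U}$, $\mathcal{K}[U]=\{(A,B)\in\mathcal{K}(X)\times\mathcal{K}(X): A\subseteq U(B),\ B\subseteq U(A)\}$. Let $\mathbb{I}=[0,1]$. A fuzzy set on $X$ is a function $u\colon X\to\mathbb{I}$; its $\alpha$-cut is $u_\alpha=\{x\in X:u(x)\ge\alpha\}$ for $\alpha\in(0,1]$, and its support is $u_0=\overline{\{x\in X:u(x)>0\}}$. $u$ is normal if $u(x)=1$ for some $x$. $\mathcal{F}(X)$ is the set of all normal upper semicontinuous fuzzy sets on $X$ with compact support. Zadeh's extension $\widehat{f}\colon\mathcal{F}(X)\to\mathcal{F}(X)$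 of a continuous $f\colon X\to X$ is $\widehat{f}(u)(x)=\sup\{u(z):z\in f^{-1}(x)\}$ if $f^{-1}(x)\ne\emptyset$, and $\widehat{f}(u)(x)=0$ otherwise. The level-wise uniformity $\mathcal{U}_\infty$ on $\mathcal{F}(X)$ has base $\{\mathcal{F}[U]:U\in\mathcal{U}\}$, where $\mathcal{F}[U]=\{(u,v)\in\mathcal{F}(X)\times\mathcal{F}(X):(u_\alpha,v_\alpha)\in\mathcal{K}[U]\text{ for all }\alpha\in\mathbb{I}\}$ (it is known that this is a base of a uniformity). *)

theory Defs
  imports "HOL-Analysis.Analysis"
begin

text \<open>
  The library class \<^class>\<open>uniform_space\<close> gives the uniformity as a filter on pairs and ties
  \<^const>\<open>open\<close> to the topology induced by it, but it does not include separation.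
\<close>

definition entourages :: "('a::uniform_space \<times> 'a) set set"
  where "entourages = {U. eventually (\<lambda>p. p \<in> U) uniformity}"

class separated_uniform_space = uniform_space +
  assumes separated: "\<Inter> {U. eventually (\<lambda>p. p \<in> U) uniformity} = Id"
begin

subclass t2_space
proof
  fix x y :: 'a
  assume "x \<noteq> y"
  then have "(x, y) \<notin> \<Inter> {U. eventually (\<lambda>p. p \<in> U) uniformity}"
    by (simp add: separated)
  then obtain E where E: "eventually (\<lambda>p. p \<in> E) uniformity" "(x, y) \<notin> E"
    by auto
  obtain D where D: "eventually D uniformity"
    "\<And>x y z. D (x, y) \<Longrightarrow> D (y, z) \<Longrightarrow> (x, z) \<in> E"
    using uniformity_transE[OF E(1)] by metis
  have sD: "eventually (\<lambda>(x, y). D (y, x)) uniformity"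
    using uniformity_sym[OF D(1)] .
  have "eventually (\<lambda>z. D (x, z)) (nhds x)"
    unfolding eventually_nhds_uniformity using D(1) by (rule eventually_mono) auto
  then obtain V where V: "open V" "x \<in> V" "\<And>z. z \<in> V \<Longrightarrow> D (x, z)"
    unfolding eventually_nhds by blast
  have "eventually (\<lambda>z. D (z, y)) (nhds y)"
    unfolding eventually_nhds_uniformity using sD by (rule eventually_mono) auto
  then obtain W where W: "open W" "y \<in> W" "\<And>z. z \<in> W \<Longrightarrow> D (z, y)"
    unfolding eventually_nhds by blast
  have "V \<inter> W = {}"
    using V(3) W(3) D(2) E(2) by blast
  with V W show "\<exists>U V. open U \<and> open V \<and> x \<in> U \<and> y \<in> V \<and> U \<inter> V = {}"
    by blast
qed

end

text \<open>Here \<open>U `` A\<close> (relational image) is the set \<open>U(A)\<close>.\<close>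

definition hyper_entourage :: "('a::uniform_space \<times> 'a) set \<Rightarrow> ('a set \<times> 'a set) set"
  where "hyper_entourage U =
    {(A, B). A \<noteq> {} \<and> compact A \<and> B \<noteq> {} \<and> compact B \<and> A \<subseteq> U `` B \<and> B \<subseteq> U `` A}"

definition upper_semicontinuous :: "('a::topological_space \<Rightarrow> real) \<Rightarrow> bool"
  where "upper_semicontinuous u \<longleftrightarrow> (\<forall>a. open {x. u x < a})"

definition support :: "('a::topological_space \<Rightarrow> real) \<Rightarrow> 'a set"
  where "support u = closure {x. u x > 0}"

definition alpha_cut :: "('a::topological_space \<Rightarrow> real) \<Rightarrow> real \<Rightarrow> 'a set"
  where "alpha_cut u \<alpha> = (if \<alpha> = 0 then support u else {x. u x \<ge> \<alpha>})"

definition fuzzy_sets :: "('a::topological_space \<Rightarrow> real) set"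
  where "fuzzy_sets =
    {u. range u \<subseteq> {0..1} \<and> (\<exists>x. u x = 1) \<and> upper_semicontinuous u \<and> compact (support u)}"

definition zadeh :: "('a \<Rightarrow> 'a) \<Rightarrow> ('a \<Rightarrow> real) \<Rightarrow> 'a \<Rightarrow> real"
  where "zadeh f u x = (if f -` {x} \<noteq> {} then SUP z\<in>f -` {x}. u z else 0)"


lemma closed_superlevel:
  assumes "upper_semicontinuous u" shows "closed {x. u x \<ge> a}"
proof -
  have "- {x. u x \<ge> a} = {x. u x < a}" by auto
  then show ?thesis using assms by (simp add: closed_def upper_semicontinuous_def)
qed

lemma compact_superlevel:
  assumes "u \<in> fuzzy_sets" "a > 0" shows "compact {x. u x \<ge> a}"
proof -
  have "{x. u x \<ge> a} \<subseteq> support u"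
    unfolding support_def using assms(2) closure_subset[of "{x. u x > 0}"] by fastforce
  then have "{x. u x \<ge> a} = support u \<inter> {x. u x \<ge> a}" by auto
  with assms closed_superlevel show ?thesis
    by (metis (mono_tags, lifting) compact_Int_closed fuzzy_sets_def mem_Collect_eq)
qed

lemma compact_cut:
  assumes "u \<in> fuzzy_sets" "0 \<le> \<alpha>" shows "compact (alpha_cut u \<alpha>)"
  using assms compact_superlevel[of u \<alpha>] by (auto simp: alpha_cut_def fuzzy_sets_def)

lemma cut_nonempty:
  assumes "u \<in> fuzzy_sets" "\<alpha> \<le> 1" shows "alpha_cut u \<alpha> \<noteq> {}"
proof -
  obtain x where x: "u x = 1" using assms by (auto simp: fuzzy_sets_def)
  then have "x \<in> support u"
    unfolding support_def using closure_subset[of "{x. u x > 0}"] by auto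
  moreover have "x \<in> {x. u x \<ge> \<alpha>}" using x assms by simp
  ultimately show ?thesis unfolding alpha_cut_def by (metis empty_iff)
qed

lemma zadeh_superlevel:
  fixes f :: "'a::t2_space \<Rightarrow> 'a"
  assumes f: "continuous_on UNIV f" and u: "u \<in> fuzzy_sets" and "a > 0"
  shows "{x. zadeh f u x \<ge> a} = f ` {z. u z \<ge> a}"
proof (intro set_eqI iffI)
  have u01: "0 \<le> u z" "u z \<le> 1" for z
    using u by (auto simp: fuzzy_sets_def image_subset_iff)
  have bdd: "bdd_above (u ` S)" for S
    using u01 by (intro bdd_aboveI[of _ 1]) auto
  fix x
  {
    assume "x \<in> f ` {z. u z \<ge> a}"
    then obtain z where z: "f z = x" "u z \<ge> a" by auto
    then have "u z \<le> (SUP z\<in>f -` {x}. u z)"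
      by (intro cSUP_upper bdd) auto
    moreover have "f -` {x} \<noteq> {}" using z by auto
    ultimately show "x \<in> {x. zadeh f u x \<ge> a}"
      using z by (auto simp: zadeh_def)
  next
    assume x: "x \<in> {x. zadeh f u x \<ge> a}"
    with \<open>a > 0\<close> have ne: "f -` {x} \<noteq> {}" and ge: "(SUP z\<in>f -` {x}. u z) \<ge> a"
      by (auto simp: zadeh_def split: if_splits)
    show "x \<in> f ` {z. u z \<ge> a}"
    proof (rule ccontr)
      assume "x \<notin> f ` {z. u z \<ge> a}"
      then have lt: "u z < a" if "f z = x" for z
        using that by force
      let ?C = "{z. u z \<ge> a/2} \<inter> f -` {x}"
      have "closed (f -` {x})"
        using f by (intro closed_vimage) auto
      then have C: "compact ?C"
        using compact_superlevel[OF u, of "a/2"] \<open>a > 0\<close> by (intro compact_Int_closed) auto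
      have op: "open {z. u z < c}" for c
        using u by (auto simp: fuzzy_sets_def upper_semicontinuous_def)
      have "?C \<subseteq> (\<Union>c\<in>{..<a}. {z. u z < c})"
        using lt dense by fastforce
      then obtain T where T: "T \<subseteq> {..<a}" "finite T" "?C \<subseteq> (\<Union>c\<in>T. {z. u z < c})"
        using compactE_image[OF C] op by metis
      define m where "m = Max (insert (a/2) T)"
      have "m < a"
        unfolding m_def using T \<open>a > 0\<close> by (subst Max_less_iff) auto
      have "u z \<le> m" if "z \<in> f -` {x}" for z
      proof (cases "u z \<ge> a/2")
        case True
        with that T(3) obtain c where "c \<in> T" "u z < c" by blast
        moreover have "c \<le> m" unfolding m_def using \<open>c \<in> T\<close> T by (intro Max_ge) auto
        ultimately show ?thesis by simp
      next
        case False
        moreover have "a/2 \<le> m" unfolding m_def using T by (intro Max_ge) auto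
        ultimately show ?thesis by simp
      qed
      then have "(SUP z\<in>f -` {x}. u z) \<le> m"
        using ne by (intro cSUP_least) auto
      with ge \<open>m < a\<close> show False by simp
    qed
  }
qed

lemma zadeh_in_fuzzy_sets:
  fixes f :: "'a::t2_space \<Rightarrow> 'a"
  assumes f: "continuous_on UNIV f" and u: "u \<in> fuzzy_sets"
  shows "zadeh f u \<in> fuzzy_sets"
proof -
  have u01: "0 \<le> u z" "u z \<le> 1" for z
    using u by (auto simp: fuzzy_sets_def image_subset_iff)
  have ran: "0 \<le> zadeh f u x" "zadeh f u x \<le> 1" for x
  proof -
    have "0 \<le> (SUP z\<in>f -` {x}. u z)" if ne: "f -` {x} \<noteq> {}"
    proof -
      from ne obtain z where "z \<in> f -` {x}" by auto
      then have "u z \<le> (SUP z\<in>f -` {x}. u z)"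
        using u01 by (intro cSUP_upper bdd_aboveI[of _ 1]) auto
      with u01[of z] show ?thesis by linarith
    qed
    then show "0 \<le> zadeh f u x" by (simp add: zadeh_def)
    have "(SUP z\<in>f -` {x}. u z) \<le> 1" if "f -` {x} \<noteq> {}"
      using that u01 by (intro cSUP_least) auto
    then show "zadeh f u x \<le> 1" by (simp add: zadeh_def)
  qed
  have cont: "continuous_on S f" for S
    using f continuous_on_subset by blast
  obtain z where "u z = 1" using u by (auto simp: fuzzy_sets_def)
  then have "f z \<in> {x. zadeh f u x \<ge> 1}"
    by (subst zadeh_superlevel[OF f u]) auto
  then have normal: "zadeh f u (f z) = 1"
    using ran(2)[of "f z"] by simp
  have usc: "upper_semicontinuous (zadeh f u)"
    unfolding upper_semicontinuous_def
  proof
    fix a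
    show "open {x. zadeh f u x < a}"
    proof (cases "a > 0")
      case True
      have "closed (f ` {z. u z \<ge> a})"
        using compact_superlevel[OF u True] cont by (intro compact_imp_closed compact_continuous_image)
      moreover have "{x. zadeh f u x < a} = - (f ` {z. u z \<ge> a})"
        using zadeh_superlevel[OF f u True] by (metis (no_types, lifting) Collect_cong Collect_neg_eq not_le)
      ultimately show ?thesis by auto
    next
      case False
      then have "{x. zadeh f u x < a} = {}"
        using ran(1) by (auto simp: not_less intro: order_trans)
      then show ?thesis by (metis open_empty)
    qed
  qed
  have sub: "{x. zadeh f u x > 0} \<subseteq> f ` support u"
  proof
    fix x assume "x \<in> {x. zadeh f u x > 0}"
    then have p: "zadeh f u x > 0" by simp
    then have "x \<in> f ` {z. u z \<ge> zadeh f u x}"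
      using zadeh_superlevel[OF f u p] by auto
    with p show "x \<in> f ` support u"
      unfolding support_def using closure_subset[of "{x. u x > 0}"] by fastforce
  qed
  have comp: "compact (f ` support u)"
    using u cont by (intro compact_continuous_image) (auto simp: fuzzy_sets_def)
  then have "support (zadeh f u) \<subseteq> f ` support u"
    unfolding support_def[of "zadeh f u"] using sub by (intro closure_minimal compact_imp_closed)
  then have "support (zadeh f u) = f ` support u \<inter> support (zadeh f u)" by auto
  moreover have "compact (f ` support u \<inter> support (zadeh f u))"
    using comp by (intro compact_Int_closed) (auto simp: support_def)
  ultimately have "compact (support (zadeh f u))" by simp
  with ran normal usc show ?thesis
    by (auto simp: fuzzy_sets_def)
qed

typedef (overloaded) 'a fuzzy = "fuzzy_sets :: ('a::separated_uniform_space \<Rightarrow> real) set"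
proof
  fix p :: 'a
  let ?u = "\<lambda>x. if x = p then 1 else 0 :: real"
  have "open {x. ?u x < a}" for a
  proof -
    consider "a \<le> 0" | "0 < a" "a \<le> 1" | "1 < a" by linarith
    then show ?thesis
    proof cases
      case 1
      then have "{x. ?u x < a} = {}" by auto
      then show ?thesis by (metis open_empty)
    next
      case 2
      then have "{x. ?u x < a} = - {p}" by auto
      then show ?thesis by auto
    next
      case 3
      then have "{x. ?u x < a} = UNIV" by auto
      then show ?thesis by (metis open_UNIV)
    qed
  qed
  moreover have "{x. ?u x > 0} = {p}" by auto
  ultimately show "?u \<in> fuzzy_sets"
    by (auto simp: fuzzy_sets_def upper_semicontinuous_def support_def)
qed

definition fuzzy_entourage ::
    "('a::separated_uniform_space \<times> 'a) set \<Rightarrow> ('a fuzzy \<times> 'a fuzzy) set"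
  where "fuzzy_entourage U =
    {(u, v). \<forall>\<alpha>\<in>{0..1}. (alpha_cut (Rep_fuzzy u) \<alpha>, alpha_cut (Rep_fuzzy v) \<alpha>) \<in> hyper_entourage U}"

lemma fuzzy_entourage_mono: "U \<subseteq> V \<Longrightarrow> fuzzy_entourage U \<subseteq> fuzzy_entourage V"
  unfolding fuzzy_entourage_def hyper_entourage_def by fast

text \<open>The level-wise uniformity: the filter generated by the sets \<^term>\<open>fuzzy_entourage U\<close>.\<close>

instantiation fuzzy :: (separated_uniform_space) uniform_space
begin

definition uniformity_fuzzy :: "('a fuzzy \<times> 'a fuzzy) filter"
  where "uniformity_fuzzy = (INF U\<in>entourages. principal (fuzzy_entourage U))"

definition open_fuzzy :: "'a fuzzy set \<Rightarrow> bool"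
  where "open_fuzzy S \<longleftrightarrow>
    (\<forall>x\<in>S. eventually (\<lambda>(x', y). x' = x \<longrightarrow> y \<in> S) uniformity)"

lemma eventually_uniformity_fuzzy:
  "eventually P (uniformity :: ('a fuzzy \<times> 'a fuzzy) filter) \<longleftrightarrow>
    (\<exists>U\<in>entourages. \<forall>p\<in>fuzzy_entourage U. P p)"
proof -
  have "\<exists>W\<in>entourages. principal (fuzzy_entourage W) \<le>
      inf (principal (fuzzy_entourage U)) (principal (fuzzy_entourage V))"
    if "U \<in> entourages" "V \<in> entourages" for U V :: "('a \<times> 'a) set"
  proof
    show "U \<inter> V \<in> entourages"
      using that by (simp add: entourages_def eventually_conj)
    show "principal (fuzzy_entourage (U \<inter> V)) \<le>
        inf (principal (fuzzy_entourage U)) (principal (fuzzy_entourage V))"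
      by (simp add: fuzzy_entourage_mono)
  qed
  moreover have "(entourages :: ('a \<times> 'a) set set) \<noteq> {}"
  proof -
    have "(UNIV :: ('a \<times> 'a) set) \<in> entourages" by (simp add: entourages_def)
    then show ?thesis by blast
  qed
  ultimately show ?thesis
    unfolding uniformity_fuzzy_def
    by (subst eventually_INF_base) (auto simp: eventually_principal)
qed

instance
proof
  show "open S \<longleftrightarrow> (\<forall>x\<in>S. eventually (\<lambda>(x', y). x' = x \<longrightarrow> y \<in> S) uniformity)"
    for S :: "'a fuzzy set"
    by (rule open_fuzzy_def)
next
  fix E :: "'a fuzzy \<times> 'a fuzzy \<Rightarrow> bool" and u
  assume "eventually E uniformity"
  then obtain U where U: "U \<in> entourages" "\<And>p. p \<in> fuzzy_entourage U \<Longrightarrow> E p"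
    by (auto simp: eventually_uniformity_fuzzy)
  have "(x, x) \<in> U" for x
    using U(1) uniformity_refl[of "\<lambda>p. p \<in> U"] by (simp add: entourages_def)
  then have "A \<subseteq> U `` A" for A by blast
  then have "(alpha_cut (Rep_fuzzy u) \<alpha>, alpha_cut (Rep_fuzzy u) \<alpha>) \<in> hyper_entourage U"
    if "\<alpha> \<in> {0..1}" for \<alpha>
    using that compact_cut[OF Rep_fuzzy, of \<alpha> u] cut_nonempty[OF Rep_fuzzy, of \<alpha> u]
    by (simp add: hyper_entourage_def)
  then have "(u, u) \<in> fuzzy_entourage U"
    by (simp add: fuzzy_entourage_def)
  with U show "E (u, u)" by blast
next
  fix E :: "'a fuzzy \<times> 'a fuzzy \<Rightarrow> bool"
  assume "eventually E uniformity"
  then obtain U where U: "U \<in> entourages" "\<And>p. p \<in> fuzzy_entourage U \<Longrightarrow> E p"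
    by (auto simp: eventually_uniformity_fuzzy)
  have "(u, v) \<in> fuzzy_entourage U \<Longrightarrow> (v, u) \<in> fuzzy_entourage U" for u v
    by (auto simp: fuzzy_entourage_def hyper_entourage_def)
  with U show "eventually (\<lambda>(x, y). E (y, x)) uniformity"
    unfolding eventually_uniformity_fuzzy by blast
next
  fix E :: "'a fuzzy \<times> 'a fuzzy \<Rightarrow> bool"
  assume "eventually E uniformity"
  then obtain U where U: "U \<in> entourages" "\<And>p. p \<in> fuzzy_entourage U \<Longrightarrow> E p"
    by (auto simp: eventually_uniformity_fuzzy)
  then have "eventually (\<lambda>p. p \<in> U) uniformity" by (simp add: entourages_def)
  from uniformity_trans[OF this] uniformity_sym
  obtain D where D: "eventually D uniformity"
    "\<And>x y z. D (x, y) \<Longrightarrow> D (y, z) \<Longrightarrow> (x, z) \<in> U"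
    by metis
  have V: "Collect D \<in> entourages" using D(1) by (simp add: entourages_def)
  have *: "(Collect D `` (Collect D `` A)) \<subseteq> U `` A" for A
    using D(2) by blast
  have "(u, w) \<in> fuzzy_entourage U"
    if uv: "(u, v) \<in> fuzzy_entourage (Collect D)" and vw: "(v, w) \<in> fuzzy_entourage (Collect D)"
    for u v w
    unfolding fuzzy_entourage_def
  proof clarify
    fix \<alpha> :: real assume a: "\<alpha> \<in> {0..1}"
    let ?A = "alpha_cut (Rep_fuzzy u) \<alpha>" and ?B = "alpha_cut (Rep_fuzzy v) \<alpha>" and ?C = "alpha_cut (Rep_fuzzy w) \<alpha>"
    have 1: "(?A, ?B) \<in> hyper_entourage (Collect D)" and 2: "(?B, ?C) \<in> hyper_entourage (Collect D)"
      using uv vw a by (auto simp: fuzzy_entourage_def)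
    have "?A \<subseteq> Collect D `` (Collect D `` ?C)" "?C \<subseteq> Collect D `` (Collect D `` ?A)"
      using 1 2 unfolding hyper_entourage_def by blast+
    with * have "?A \<subseteq> U `` ?C" "?C \<subseteq> U `` ?A" by blast+
    with 1 2 show "(?A, ?C) \<in> hyper_entourage U"
      by (simp add: hyper_entourage_def)
  qed
  with U V show "\<exists>D. eventually D uniformity \<and> (\<forall>x y z. D (x, y) \<longrightarrow> D (y, z) \<longrightarrow> E (x, z))"
    unfolding eventually_uniformity_fuzzy
    by (intro exI[of _ "\<lambda>p. p \<in> fuzzy_entourage (Collect D)"]) blast
qed

end

text \<open>
  For continuous \<open>f\<close> the lemma \<open>Rep_zadeh_extension\<close> shows that the argument of
  \<^const>\<open>Abs_fuzzy\<close> below is an element of the represented set; for other \<open>f\<close> the value is irrelevant.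
\<close>

definition zadeh_extension ::
    "('a::separated_uniform_space \<Rightarrow> 'a) \<Rightarrow> 'a fuzzy \<Rightarrow> 'a fuzzy"
  where "zadeh_extension f u = Abs_fuzzy (zadeh f (Rep_fuzzy u))"

lemma Rep_zadeh_extension:
  assumes "continuous_on UNIV f"
  shows "Rep_fuzzy (zadeh_extension f u) = zadeh f (Rep_fuzzy u)"
  unfolding zadeh_extension_def
  by (intro Abs_fuzzy_inverse zadeh_in_fuzzy_sets assms Rep_fuzzy)

end

theory Submission
  imports Defs
begin

text \<open>
  Every level of \<open>zadeh f u\<close>, including the support, is the image under \<open>f\<close> of the
  corresponding level of \<open>u\<close>, and all levels of \<open>u\<close> lie in the compact set \<open>support u\<close>.
  A continuous map is uniformly continuous at a compact set, even when only one of the two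
  points has to lie in that set, so a single entourage controls all levels at once.
\<close>

text \<open>Each point has a neighbourhood \<open>V\<close> and an entourage \<open>Q\<close> that
  controls every pair starting in \<open>V\<close>. Finitely many such \<open>V\<close> cover
  \<open>K\<close>, and the intersection of their \<open>Q\<close> works; the second point may leave
  \<open>K\<close> because \<open>V\<close> restricts only the first.\<close>

lemma uniformly_continuous_at_compact:
  fixes f :: "'a::uniform_space \<Rightarrow> 'b::uniform_space"
  assumes f: "continuous_on UNIV f" and K: "compact K" and E: "eventually E uniformity"
  shows "eventually (\<lambda>(x, y). x \<in> K \<longrightarrow> E (f x, f y)) uniformity"
proof -
  obtain D where D: "eventually D uniformity"
    "\<And>x y. D (x, y) \<Longrightarrow> D (y, x)" "\<And>x y z. D (x, y) \<Longrightarrow> D (y, z) \<Longrightarrow> E (x, z)"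
  proof -
    obtain D0 where D0: "eventually D0 uniformity"
      "\<And>x y z. D0 (x, y) \<Longrightarrow> D0 (y, z) \<Longrightarrow> E (x, z)"
      using uniformity_trans[OF E] by metis
    then have "eventually (\<lambda>(x, y). D0 (x, y) \<and> D0 (y, x)) uniformity"
      using uniformity_sym[OF D0(1)] by (simp add: case_prod_beta' eventually_conj)
    with D0(2) show thesis by (intro that[of "\<lambda>(x, y). D0 (x, y) \<and> D0 (y, x)"]) auto
  qed
  have "\<exists>Q V. eventually Q uniformity \<and> open V \<and> x \<in> V \<and>
      (\<forall>y\<in>V. \<forall>z. Q (y, z) \<longrightarrow> E (f y, f z))" for x
  proof -
    have "eventually (\<lambda>w. D (f x, w)) (nhds (f x))"
      unfolding eventually_nhds_uniformity using D(1) by (rule eventually_mono) auto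
    moreover have "filterlim f (nhds (f x)) (nhds x)"
      using f by (simp add: continuous_on_def tendsto_at_iff_tendsto_nhds)
    ultimately have near: "eventually (\<lambda>y. D (f x, f y)) (nhds x)"
      by (rule eventually_compose_filterlim)
    then have "eventually (\<lambda>(x', y). x' = x \<longrightarrow> D (f x, f y)) uniformity"
      by (simp add: eventually_nhds_uniformity)
    \<comment> \<open>Halving the entourage that encodes continuity at \<open>x\<close>: two
      \<open>Q\<close>-steps from \<open>x\<close> still end at a point whose image is
      \<open>D\<close>-close to \<open>f x\<close>.\<close>
    from uniformity_trans[OF this] obtain Q where Q: "eventually Q uniformity"
      "\<And>y z. Q (x, y) \<Longrightarrow> Q (y, z) \<Longrightarrow> D (f x, f z)"
      by auto
    have "eventually (\<lambda>y. Q (x, y)) (nhds x)"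
      unfolding eventually_nhds_uniformity using Q(1) by (rule eventually_mono) auto
    then have "eventually (\<lambda>y. Q (x, y) \<and> D (f x, f y)) (nhds x)"
      using near by (rule eventually_conj)
    then obtain V where V: "open V" "x \<in> V" "\<And>y. y \<in> V \<Longrightarrow> Q (x, y) \<and> D (f x, f y)"
      unfolding eventually_nhds by blast
    \<comment> \<open>Both \<open>f y\<close> and \<open>f z\<close> are \<open>D\<close>-close to
      \<open>f x\<close>, so symmetry of \<open>D\<close> links them through
      \<open>f x\<close>.\<close>
    have "E (f y, f z)" if "y \<in> V" "Q (y, z)" for y z
      using V(3)[OF that(1)] that(2) D(3)[OF D(2)] Q(2) by metis
    with Q(1) V(1,2) show ?thesis by (intro exI[of _ Q] exI[of _ V]) simp
  qed
  then obtain Q V where Q: "\<And>x. eventually (Q x) uniformity" and V: "\<And>x. open (V x)" "\<And>x. x \<in> V x"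
    and QV: "\<And>x y z. y \<in> V x \<Longrightarrow> Q x (y, z) \<Longrightarrow> E (f y, f z)"
    by metis
  obtain T where T: "finite T" "K \<subseteq> (\<Union>x\<in>T. V x)"
    using compactE_image[OF K, of K V] V by (metis UN_I subsetI)
  have "eventually (\<lambda>p. \<forall>x\<in>T. Q x p) uniformity"
    using T(1) Q by (simp add: eventually_ball_finite)
  then show ?thesis
    by (rule eventually_mono) (use T(2) QV in blast)
qed

lemma alpha_cut_zadeh:
  fixes f :: "'a::t2_space \<Rightarrow> 'a"
  assumes f: "continuous_on UNIV f" and u: "u \<in> fuzzy_sets" and "0 \<le> \<alpha>"
  shows "alpha_cut (zadeh f u) \<alpha> = f ` alpha_cut u \<alpha>"
proof (cases "\<alpha> = 0")
  case False
  with assms show ?thesis by (simp add: alpha_cut_def zadeh_superlevel)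
next
  case True
  have cont: "continuous_on S f" for S
    using f continuous_on_subset by blast
  \<comment> \<open>Images commute with unions, so this carries \<open>zadeh_superlevel\<close> over
    to the strict level at 0.\<close>
  have pos: "{x. v x > 0} = (\<Union>a\<in>{0<..}. {x. v x \<ge> a})" for v :: "'a \<Rightarrow> real"
    by force
  have img: "{x. zadeh f u x > 0} = f ` {x. u x > 0}"
    by (simp add: pos[of "zadeh f u"] pos[of u] zadeh_superlevel[OF f u] image_UN)
  have "closed (f ` support u)"
    using u cont by (intro compact_imp_closed compact_continuous_image) (auto simp: fuzzy_sets_def)
  then have "closure (f ` {x. u x > 0}) = f ` support u"
    using closure_subset[of "{x. u x > 0}"] image_closure_subset[OF cont closed_closure closure_subset]
    unfolding support_def by (intro antisym closure_minimal image_mono) auto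
  with True show ?thesis by (simp add: alpha_cut_def support_def[of "zadeh f u"] img)
qed

lemma alpha_cut_subset_support:
  assumes "0 \<le> \<alpha>" shows "alpha_cut u \<alpha> \<subseteq> support u"
proof (cases "\<alpha> = 0")
  case False
  with assms have "{x. u x \<ge> \<alpha>} \<subseteq> {x. u x > 0}" by auto
  with False closure_subset show ?thesis by (auto simp: alpha_cut_def support_def)
qed (simp add: alpha_cut_def)

theorem theorem2p12:
  fixes f :: "'a::separated_uniform_space \<Rightarrow> 'a"
  assumes "continuous_on UNIV f"
  shows "continuous_on UNIV (zadeh_extension f)"
proof -
  have "eventually (\<lambda>v. (zadeh_extension f u, zadeh_extension f v) \<in> fuzzy_entourage E) (nhds u)"
    if E: "E \<in> entourages" for u and E :: "('a \<times> 'a) set"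
  proof -
    let ?K = "support (Rep_fuzzy u)"
    have K: "compact ?K"
      using Rep_fuzzy[of u] by (simp add: fuzzy_sets_def)
    have E1: "eventually (\<lambda>p. p \<in> E) uniformity"
      using E by (simp add: entourages_def)
    have 1: "eventually (\<lambda>(x, y). x \<in> ?K \<longrightarrow> (f x, f y) \<in> E) uniformity"
      using uniformly_continuous_at_compact[OF assms K E1] .
    \<comment> \<open>\<open>E\<close> need not be symmetric, so the case of the second point in
      \<open>?K\<close> comes from transposing \<open>E\<close> and then the resulting
      entourage.\<close>
    have 2: "eventually (\<lambda>(y, x). x \<in> ?K \<longrightarrow> (f y, f x) \<in> E) uniformity"
      using uniformity_sym[OF uniformly_continuous_at_compact[OF assms K uniformity_sym[OF E1]]]
      by simp
    \<comment> \<open>In the two inclusions of \<open>hyper_entourage\<close> the point from the cut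
      of \<open>u\<close> is once the first and once the second coordinate. Cuts of \<open>v\<close>
      may leave \<open>?K\<close>, and \<open>U\<close> does not depend on \<alpha>.\<close>
    define U where "U = {(x, y). (x \<in> ?K \<longrightarrow> (f x, f y) \<in> E) \<and> (y \<in> ?K \<longrightarrow> (f x, f y) \<in> E)}"
    have U: "U \<in> entourages"
      using eventually_conj[OF 1 2] by (simp add: entourages_def U_def case_prod_beta')
    have "(zadeh_extension f u, zadeh_extension f v) \<in> fuzzy_entourage E"
      if uv: "(u, v) \<in> fuzzy_entourage U" for v
      unfolding fuzzy_entourage_def
    proof clarify
      fix \<alpha> :: real assume a: "\<alpha> \<in> {0..1}"
      let ?A = "alpha_cut (Rep_fuzzy u) \<alpha>" and ?B = "alpha_cut (Rep_fuzzy v) \<alpha>"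
      have AB: "(?A, ?B) \<in> hyper_entourage U"
        using uv a by (auto simp: fuzzy_entourage_def)
      have "?A \<subseteq> ?K"
        using a by (intro alpha_cut_subset_support) simp
      then have "f ` ?A \<subseteq> E `` (f ` ?B)" "f ` ?B \<subseteq> E `` (f ` ?A)"
        using AB unfolding hyper_entourage_def U_def by blast+
      moreover have "compact (f ` S)" if "compact S" for S
        using that assms by (meson compact_continuous_image continuous_on_subset subset_UNIV)
      ultimately have "(f ` ?A, f ` ?B) \<in> hyper_entourage E"
        using AB by (simp add: hyper_entourage_def)
      then show "(alpha_cut (Rep_fuzzy (zadeh_extension f u)) \<alpha>,
          alpha_cut (Rep_fuzzy (zadeh_extension f v)) \<alpha>) \<in> hyper_entourage E"
        using a by (simp add: Rep_zadeh_extension[OF assms] alpha_cut_zadeh[OF assms Rep_fuzzy])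
    qed
    with U show ?thesis
      unfolding eventually_nhds_uniformity eventually_uniformity_fuzzy by blast
  qed
  then have "filterlim (zadeh_extension f) (nhds (zadeh_extension f u)) (nhds u)" for u
    unfolding filterlim_iff eventually_nhds_uniformity[of _ "zadeh_extension f u"]
      eventually_uniformity_fuzzy
    by (fast elim: eventually_mono)
  then show ?thesis
    by (simp add: continuous_on_def tendsto_at_iff_tendsto_nhds)
qed

end
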